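(* In the market model and preference-fitting setting of the context, assume that $\mathcal{X}_T^*\in C^1(0,\infty)$ and that $\max_{0\le i\le n-1}|\xi_i^n-\xi_{i+1}^n|=O(1/n)$ as $n\to\infty$. Then for any $t\in[0,T]$ the fitted wealth process $X^n$ and the optimal wealth process $X^*$ satisfy, as $n\to\infty$, $|X_t^n-X_t^*|=O(1/n)$ a.s., $\mathbb{E}[|X_t^n-X_t^*|]=O(1/n)$, and $\mathbb{E}\big[\int_0^T|X_t^n-X_t^*|\,dt\big]=O(1/n)$.
   Context: Market. Fix $T>0$, $x_0>0$, $r\in\mathbb{R}$, $\boldsymbol{\mu}\in\mathbb{R}^m$ and a positive definite (hence invertible) matrix $\boldsymbol{\sigma}\in\mathbb{R}^{m\times m}$. $\mathbf{W}$ is an $m$-dimensional standard Brownian motion with augmented filtration $\{\mathcal{F}_t\}$. Put $\boldsymbol{\theta}=\boldsymbol{\sigma}^{-1}(\boldsymbol{\mu}-r\mathbf{1}_m)$, assumed $\neq0$, and $\xi_t=\exp\{-(r+\tfrac12\|\boldsymbol{\theta}\|_2^2)t-\boldsymbol{\theta}^\top\mathbf{W}_t\}$ (pricing kernel). For $p\in(0,1)$ let $\xi^p=\exp\{-(r+\tfrac12\|\boldsymbol{\theta}\|_2^2)T-\|\boldsymbol{\theta}\|_2\sqrt{T}\,\Phi^{-1}(p)\}$, with $\Phi$ the standard normal distribution function; $p\mapsto\xi^p$ is strictly decreasing. Class $\mathcal{C}$: functions on $(0,\infty)$ that are finite, nonnegative, decreasing (non-increasing), left continuous, and tend to $\infty$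 at $0^+$. Preference-fitting setting. Fix $1>p_0^1>p_1^1>0$ and $\kappa_0^1,\kappa_1^1>0$, and put $y_0^1=\kappa_0^1/\xi^{p_0^1}$, $y_1^1=\kappa_1^1/\xi^{p_1^1}$, with $y_0^1\ge y_1^1$. The (unknown) optimal terminal wealth of the investor is $X_T^*=\mathcal{X}_T^*(\xi_T)$, where $\mathcal{X}_T^*\in\mathcal{C}$, $\mathbb{E}[\xi_T\mathcal{X}_T^*(\xi_T)]=x_0$, $\mathcal{X}_T^*(\xi)=\kappa_0^1/\xi$ for $\xi<\xi^{p_0^1}$ and $\mathcal{X}_T^*(\xi)=\kappa_1^1/\xi$ for $\xi>\xi^{p_1^1}$. For each $n\ge1$ the investor has given probabilities $p_0^1=p_0^n>p_1^n>\dots>p_n^n=p_1^1$ (the set for $n+1$ is obtained from the set for $n$ by inserting one new point of $(p_1^1,p_0^1)$), and $y_i^n=\mathcal{X}_T^*(\xi_i^n)$, where $\xi_i^n:=\xi^{p_i^n}$; thus $y_0^n\ge y_1^n\ge\dots\ge y_n^n$. The pairs satisfy the budget bounds $$\sum_{i=0}^{n-1}y_{i+1}^n\mathbb{E}\big[\xi_T\mathbf{1}_{\{\xi_T\in(\xi_i^n,\xi_{i+1}^n)\}}\big]+\kappa_0^1(1-p_0^1)+\kappa_1^1p_1^1\le x_0<\sum_{i=0}^{n-1}y_i^n\mathbb{E}\big[\xi_T\mathbf{1}_{\{\xi_T\in(\xi_i^n,\xi_{i+1}^n)\}}\big]+\kappa_0^1(1-p_0^1)+\kappa_1^1p_1^1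 .$$ The fitted terminal wealth is $X_T^n=\mathcal{X}_T^n(\xi_T)$, where $\mathcal{X}_T^n\in\mathcal{C}$ is any function with: $\mathcal{X}_T^n=\mathcal{X}_T^*$ on $(0,\xi_0^n)\cup(\xi_n^n,\infty)$; $\mathcal{X}_T^n(\xi_i^n)=y_i^n$ for $0\le i\le n$; on each interval $(\xi_i^n,\xi_{i+1}^n)$, $\mathcal{X}_T^n$ is a hyperbolic expression, meaning a function of one of the forms $h+c\,\xi^{-1/(1-\gamma)}$ ($h\in\mathbb{R},c>0,\gamma<1$), $h-c\,\xi^{1/(\gamma-1)}$ ($h\in\mathbb{R},c>0,\gamma>1$), or a constant; and $\mathbb{E}[\xi_T\mathcal{X}_T^n(\xi_T)]=x_0$. The fitted and optimal wealth processes are $X_t^n=\xi_t^{-1}\mathbb{E}[\xi_TX_T^n|\mathcal{F}_t]$ and $X_t^*=\xi_t^{-1}\mathbb{E}[\xi_TX_T^*|\mathcal{F}_t]$, $0\le t\le T$. *)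

theory Defs
  imports "HOL-Probability.Probability" "HOL-Library.Landau_Symbols"
begin

section \<open>Brownian motion\<close>

text \<open>
  Standard Brownian motion in \<open>real ^ 'm\<close> on the time interval \<open>[0, T]\<close>. The last but one
  condition says that an increment over \<open>[s, t]\<close> has the law $N(0, (t-s) I_m)$; recall that
  the library's \<open>normal_density\<close> takes the standard deviation.
\<close>

definition standard_brownian_motion ::
    "'a measure \<Rightarrow> real \<Rightarrow> (real \<Rightarrow> 'a \<Rightarrow> real ^ 'm::finite) \<Rightarrow> bool" where
  "standard_brownian_motion M T W \<longleftrightarrow>
     prob_space M \<and>
     (\<forall>t\<in>{0..T}. W t \<in> borel_measurable M) \<and>
     (AE \<omega> in M. W 0 \<omega> = 0) \<and>
     (\<forall>(k::nat) \<tau>. (\<forall>j\<le>k. \<tau> j \<in> {0..T}) \<and> (\<forall>j<k. \<tau> j \<le> \<tau> (Suc j)) \<longrightarrow>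
        prob_space.indep_vars M (\<lambda>_. borel) (\<lambda>j \<omega>. W (\<tau> (Suc j)) \<omega> - W (\<tau> j) \<omega>) {..<k}) \<and>
     (\<forall>s t. 0 \<le> s \<and> s < t \<and> t \<le> T \<longrightarrow>
        prob_space.indep_vars M (\<lambda>_. borel) (\<lambda>i \<omega>. (W t \<omega> - W s \<omega>) $ i) UNIV \<and>
        (\<forall>i. distributed M lborel (\<lambda>\<omega>. (W t \<omega> - W s \<omega>) $ i) (normal_density 0 (sqrt (t - s))))) \<and>
     (AE \<omega> in M. continuous_on {0..T} (\<lambda>t. W t \<omega>))"

text \<open>
  The filtration generated by \<open>W\<close> and all null events; if \<open>M\<close> is complete, \<open>null_sets M\<close> contains
  every subset of a null event, so that this is the usual augmentation.
\<close>

definition augmented_filtration ::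
    "'a measure \<Rightarrow> (real \<Rightarrow> 'a \<Rightarrow> real ^ 'm::finite) \<Rightarrow> real \<Rightarrow> 'a measure" where
  "augmented_filtration M W t =
     sigma (space M) ((\<Union>s\<in>{0..t}. {W s -` A \<inter> space M | A. A \<in> sets borel}) \<union> null_sets M)"

lemma subalgebra_augmented_filtration:
  assumes "standard_brownian_motion M T W" "t \<le> T"
  shows "subalgebra M (augmented_filtration M W t)"
proof -
  have *: "W s -` A \<inter> space M \<in> sets M" if "s \<in> {0..t}" "A \<in> sets borel" for s A
    using that assms unfolding standard_brownian_motion_def
    by (intro measurable_sets[of "W s" M borel]) auto
  let ?G = "(\<Union>s\<in>{0..t}. {W s -` A \<inter> space M | A. A \<in> sets borel}) \<union> null_sets M"
  have "?G \<subseteq> sets M" using * by auto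
  moreover from this have "?G \<subseteq> Pow (space M)" using sets.space_closed by blast
  ultimately show ?thesis
    unfolding subalgebra_def augmented_filtration_def
    by (simp add: space_measure_of sets_measure_of sets.sigma_sets_subset)
qed


section \<open>Market\<close>

text \<open>Symmetry is not required.\<close>

definition pos_def_matrix :: "real ^ 'm ^ 'm::finite \<Rightarrow> bool" where
  "pos_def_matrix A \<longleftrightarrow> (\<forall>v. v \<noteq> 0 \<longrightarrow> v \<bullet> (A *v v) > 0)"

definition market_price_of_risk ::
    "real \<Rightarrow> real ^ 'm \<Rightarrow> real ^ 'm ^ 'm::finite \<Rightarrow> real ^ 'm" where
  "market_price_of_risk r \<mu> \<sigma> = matrix_inv \<sigma> *v (\<mu> - (\<chi> i. r))"

definition pricing_kernel ::
    "real \<Rightarrow> real ^ 'm::finite \<Rightarrow> (real \<Rightarrow> 'a \<Rightarrow> real ^ 'm) \<Rightarrow> real \<Rightarrow> 'a \<Rightarrow> real" where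
  "pricing_kernel r \<theta> W t \<omega> = exp (- (r + (norm \<theta>)\<^sup>2 / 2) * t - \<theta> \<bullet> W t \<omega>)"

text \<open>
  The standard normal distribution function is a bijection from the reals onto \<open>(0, 1)\<close>, so for
  \<open>0 < p < 1\<close> the value of \<open>inv\<close> below is its unique preimage of \<open>p\<close>. The event that the pricing
  kernel at time \<open>T\<close> is at least \<open>kernel_level r \<theta> T p\<close> has probability \<open>p\<close>.
\<close>

definition kernel_level :: "real \<Rightarrow> real ^ 'm::finite \<Rightarrow> real \<Rightarrow> real \<Rightarrow> real" where
  "kernel_level r \<theta> T p =
     exp (- (r + (norm \<theta>)\<^sup>2 / 2) * T - norm \<theta> * sqrt T * inv (cdf std_normal_distribution) p)"


section \<open>Terminal wealth as a function of the pricing kernel\<close>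

text \<open>Only the values on \<open>(0, \<infinity>)\<close> matter.\<close>

definition wealth_class :: "(real \<Rightarrow> real) set" where
  "wealth_class = {f. (\<forall>z>0. f z \<ge> 0) \<and> antimono_on {0<..} f \<and>
     (\<forall>z>0. continuous (at_left z) f) \<and> filterlim f at_top (at_right 0)}"

definition hyperbolic_on :: "real set \<Rightarrow> (real \<Rightarrow> real) \<Rightarrow> bool" where
  "hyperbolic_on S f \<longleftrightarrow>
     (\<exists>h c \<gamma>. c > 0 \<and> \<gamma> < 1 \<and> (\<forall>z\<in>S. f z = h + c * z powr (- 1 / (1 - \<gamma>)))) \<or>
     (\<exists>h c \<gamma>. c > 0 \<and> \<gamma> > 1 \<and> (\<forall>z\<in>S. f z = h - c * z powr (1 / (\<gamma> - 1)))) \<or>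
     (\<exists>h. \<forall>z\<in>S. f z = h)"

text \<open>
  The conditional expectations determine the wealth at each time only up to a null event; joint
  measurability is what makes the time integral of the process meaningful. Any such version,
  in particular a continuous one, is admitted.
\<close>

definition wealth_process ::
    "'a measure \<Rightarrow> real \<Rightarrow> (real \<Rightarrow> 'a \<Rightarrow> real ^ 'm::finite) \<Rightarrow> (real \<Rightarrow> 'a \<Rightarrow> real) \<Rightarrow> ('a \<Rightarrow> real) \<Rightarrow>
     (real \<Rightarrow> 'a \<Rightarrow> real) \<Rightarrow> bool" where
  "wealth_process M T W \<xi> X_T X \<longleftrightarrow>
     (\<lambda>(t, \<omega>). X t \<omega>) \<in> borel_measurable (restrict_space borel {0..T} \<Otimes>\<^sub>M M) \<and>
     (\<forall>t\<in>{0..T}. AE \<omega> in M.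
        X t \<omega> = inverse (\<xi> t \<omega>) *
          real_cond_exp M (augmented_filtration M W t) (\<lambda>\<omega>. \<xi> T \<omega> * X_T \<omega>) \<omega>)"

end

theory Submission
  imports Defs
begin

text \<open>
  On a mesh cell, the fitted and the optimal terminal wealth are non-increasing in the pricing
  kernel and agree at both nodes, so they differ by at most the increment of the optimal one over
  the cell, which is of the order of the mesh. The error vanishes above the last node, hence it
  stays of order \<open>1/n\<close> after multiplication by $\xi_T$, and conditioning preserves this
  deterministic bound. The wealth processes therefore differ by $O(1/n)\,\xi_t^{-1}$, and
  $E[\xi_t^{-1}] = e^{(r + |\theta|^2) t}$ is bounded on $[0,T]$.
\<close>

section \<open>Exponential moments of Brownian motion and of the inverse pricing kernel\<close>

lemma normal_density_exp_tilt:
  assumes "s > 0"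
  shows "normal_density 0 s x * exp (a * x) = exp (a\<^sup>2 * s\<^sup>2 / 2) * normal_density (a * s\<^sup>2) s x"
proof -
  \<comment> \<open>Completing the square: the tilt moves the mean from 0 to
    \<open>a * s\<^sup>2\<close> and keeps the standard deviation, so the normalising constant of
    the density is unaffected.\<close>
  have "- x\<^sup>2 / (2 * s\<^sup>2) + a * x = a\<^sup>2 * s\<^sup>2 / 2 + - (x - a * s\<^sup>2)\<^sup>2 / (2 * s\<^sup>2)"
    using assms by (simp add: field_simps power2_eq_square)
  then have "exp (- x\<^sup>2 / (2 * s\<^sup>2)) * exp (a * x)
      = exp (a\<^sup>2 * s\<^sup>2 / 2) * exp (- (x - a * s\<^sup>2)\<^sup>2 / (2 * s\<^sup>2))"
    unfolding exp_add[symmetric] by simp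
  then show ?thesis unfolding normal_density_def by simp
qed

text \<open>After the tilt a constant multiple of another normal density remains, and that density
  has total mass 1. Working with nonnegative integrals yields finiteness together with the
  value.\<close>

lemma nn_integral_exp_normal:
  assumes X: "distributed M lborel X (normal_density 0 s)" and s: "s > 0"
  shows "(\<integral>\<^sup>+\<omega>. ennreal (exp (a * X \<omega>)) \<partial>M) = ennreal (exp (a\<^sup>2 * s\<^sup>2 / 2))"
proof -
  have "(\<integral>\<^sup>+\<omega>. ennreal (exp (a * X \<omega>)) \<partial>M)
      = (\<integral>\<^sup>+x. ennreal (normal_density 0 s x) * ennreal (exp (a * x)) \<partial>lborel)"
    by (rule distributed_nn_integral[OF X, symmetric]) simp
  also have "\<dots> = (\<integral>\<^sup>+x. ennreal (exp (a\<^sup>2 * s\<^sup>2 / 2)) * ennreal (normal_density (a * s\<^sup>2) s x) \<partial>lborel)"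
    by (simp add: normal_density_exp_tilt[OF s] flip: ennreal_mult)
  also have "\<dots> = ennreal (exp (a\<^sup>2 * s\<^sup>2 / 2)) * (\<integral>\<^sup>+x. ennreal (normal_density (a * s\<^sup>2) s x) \<partial>lborel)"
    by (rule nn_integral_cmult) simp
  also have "(\<integral>\<^sup>+x. ennreal (normal_density (a * s\<^sup>2) s x) \<partial>lborel) = 1"
    using s by (subst nn_integral_eq_integral) (simp_all add: normal_density_nonneg)
  finally show ?thesis by simp
qed

text \<open>Almost surely \<open>W 0\<close> vanishes, so \<open>W t\<close> may be replaced by its
  increment from time 0. The coordinates of the increment are independent, hence the expectation
  factors into one-dimensional moments whose exponents add up to the squared norm.\<close>

lemma nn_integral_exp_brownian:
  fixes W :: "real \<Rightarrow> 'a \<Rightarrow> real ^ 'm::finite"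
  assumes W: "standard_brownian_motion M T W" and t: "0 \<le> t" "t \<le> T"
  shows "(\<integral>\<^sup>+\<omega>. ennreal (exp (\<theta> \<bullet> W t \<omega>)) \<partial>M) = ennreal (exp ((norm \<theta>)\<^sup>2 * t / 2))"
proof -
  interpret prob_space M using W by (simp add: standard_brownian_motion_def)
  have W0: "AE \<omega> in M. W 0 \<omega> = 0" using W by (simp add: standard_brownian_motion_def)
  show ?thesis
  \<comment> \<open>The Gaussian law of increments is available only over intervals of positive
    length, so time 0 is settled by \<open>W 0 = 0\<close>.\<close>
  proof (cases "t = 0")
    case True
    have "(\<integral>\<^sup>+\<omega>. ennreal (exp (\<theta> \<bullet> W t \<omega>)) \<partial>M) = (\<integral>\<^sup>+\<omega>. 1 \<partial>M)"
      using W0 by (intro nn_integral_cong_AE) (auto simp: True)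
    then show ?thesis by (simp add: emeasure_space_1 True)
  next
    case False
    then have t': "t > 0" using t by simp
    let ?V = "\<lambda>i \<omega>. (W t \<omega> - W 0 \<omega>) $ i"
    have ind: "indep_vars (\<lambda>_. borel) ?V UNIV"
      and dist: "\<And>i. distributed M lborel (?V i) (normal_density 0 (sqrt t))"
      using W t t' by (force simp: standard_brownian_motion_def)+
    have "(\<integral>\<^sup>+\<omega>. ennreal (exp (\<theta> \<bullet> W t \<omega>)) \<partial>M)
        = (\<integral>\<^sup>+\<omega>. (\<Prod>i\<in>UNIV. ennreal (exp (\<theta> $ i * ?V i \<omega>))) \<partial>M)"
      using W0 by (intro nn_integral_cong_AE)
        (auto simp: inner_vec_def exp_sum prod_ennreal elim!: eventually_mono)
    also have "\<dots> = (\<Prod>i\<in>UNIV. \<integral>\<^sup>+\<omega>. ennreal (exp (\<theta> $ i * ?V i \<omega>)) \<partial>M)"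
      by (intro indep_vars_nn_integral indep_vars_compose2[OF ind]) simp_all
    also have "\<dots> = (\<Prod>i\<in>UNIV. ennreal (exp ((\<theta> $ i)\<^sup>2 * t / 2)))"
      using t' by (intro prod.cong refl) (subst nn_integral_exp_normal[OF dist], simp_all)
    also have "\<dots> = ennreal (exp (\<Sum>i\<in>UNIV. (\<theta> $ i)\<^sup>2 * t / 2))"
      by (simp add: exp_sum prod_ennreal)
    also have "(\<Sum>i\<in>UNIV. (\<theta> $ i)\<^sup>2 * t / 2) = (norm \<theta>)\<^sup>2 * t / 2"
      by (simp add: norm_vec_def L2_set_def sum_nonneg sum_distrib_right sum_divide_distrib)
    finally show ?thesis .
  qed
qed

lemma pricing_kernel_pos: "pricing_kernel r \<theta> W t \<omega> > 0"
  by (simp add: pricing_kernel_def)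

text \<open>The drift of the kernel contributes half of the squared norm of \<open>\<theta>\<close>,
  and the exponential moment of \<open>\<theta> \<bullet> W t\<close> contributes the other
  half.\<close>

lemma nn_integral_inverse_pricing_kernel:
  fixes W :: "real \<Rightarrow> 'a \<Rightarrow> real ^ 'm::finite"
  assumes W: "standard_brownian_motion M T W" and t: "0 \<le> t" "t \<le> T"
  shows "(\<integral>\<^sup>+\<omega>. ennreal (inverse (pricing_kernel r \<theta> W t \<omega>)) \<partial>M) = ennreal (exp ((r + (norm \<theta>)\<^sup>2) * t))"
proof -
  have [measurable]: "W t \<in> borel_measurable M"
    using W t by (auto simp: standard_brownian_motion_def)
  have "(\<integral>\<^sup>+\<omega>. ennreal (inverse (pricing_kernel r \<theta> W t \<omega>)) \<partial>M)
      = (\<integral>\<^sup>+\<omega>. ennreal (exp ((r + (norm \<theta>)\<^sup>2 / 2) * t)) * ennreal (exp (\<theta> \<bullet> W t \<omega>)) \<partial>M)"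
    by (simp add: pricing_kernel_def algebra_simps flip: exp_minus ennreal_mult exp_add)
  also have "\<dots> = ennreal (exp ((r + (norm \<theta>)\<^sup>2 / 2) * t)) * ennreal (exp ((norm \<theta>)\<^sup>2 * t / 2))"
    by (subst nn_integral_cmult) (simp_all add: nn_integral_exp_brownian[OF W t])
  also have "\<dots> = ennreal (exp ((r + (norm \<theta>)\<^sup>2) * t))"
    by (simp add: algebra_simps flip: ennreal_mult exp_add)
  finally show ?thesis .
qed

section \<open>Deterministic interpolation error of monotone functions\<close>

lemma C1_lipschitz_on_Icc:
  fixes g :: "real \<Rightarrow> real"
  assumes g: "g C1_differentiable_on S" and S: "{a..b} \<subseteq> S"
  obtains L where "L \<ge> 0" "\<And>x y. x \<in> {a..b} \<Longrightarrow> y \<in> {a..b} \<Longrightarrow> \<bar>g x - g y\<bar> \<le> L * \<bar>x - y\<bar>"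
proof -
  obtain D where D: "\<And>x. x \<in> S \<Longrightarrow> (g has_vector_derivative D x) (at x)" and cD: "continuous_on S D"
    using g unfolding C1_differentiable_on_def by blast
  \<comment> \<open>The continuous derivative is bounded on the compact interval; this bound serves
    as the Lipschitz constant through the mean value inequality.\<close>
  have "compact (D ` {a..b})"
    using continuous_on_subset[OF cD S] by (intro compact_continuous_image) auto
  then obtain L where L: "L > 0" "\<And>x. x \<in> {a..b} \<Longrightarrow> \<bar>D x\<bar> \<le> L"
    using compact_imp_bounded bounded_pos by (metis imageI real_norm_def)
  have "\<bar>g x - g y\<bar> \<le> L * \<bar>x - y\<bar>" if "x \<in> {a..b}" "y \<in> {a..b}" for x y
  proof -
    have "norm (g x - g y) \<le> L * norm (x - y)"
    proof (rule field_differentiable_bound[of "{a..b}" g D])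
      show "(g has_field_derivative D u) (at u within {a..b})" if "u \<in> {a..b}" for u
        using D[of u] S that
        by (simp add: has_real_derivative_iff_has_vector_derivative
            has_vector_derivative_at_within subset_iff)
    qed (use L(2) that in auto)
    then show ?thesis by simp
  qed
  then show thesis using that L(1) by (meson less_imp_le)
qed

text \<open>A discrete intermediate value argument: if no cell bracketed \<open>x\<close>, then
  \<open>z i \<le> x\<close> would propagate from index 0 up to \<open>n\<close>, and
  \<open>x \<le> z n\<close> would make the last cell bracket \<open>x\<close> after all.\<close>

lemma exists_bracketing_index:
  fixes z :: "nat \<Rightarrow> 'b::linorder"
  assumes "z 0 \<le> x" "x \<le> z n" "n \<ge> 1"
  shows "\<exists>i<n. z i \<le> x \<and> x \<le> z (Suc i)"
proof (rule ccontr)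
  assume no: "\<not> ?thesis"
  have "z i \<le> x" if "i \<le> n" for i
    using that assms(1) no by (induction i) (auto simp: Suc_le_eq not_le intro: less_imp_le)
  moreover obtain m where "n = Suc m" using assms(3) by (cases n) auto
  ultimately show False using no assms(2) by auto
qed

text \<open>The factor \<open>x\<close> stands for the pricing kernel at maturity, since it is the
  weighted error that is conditioned later. The weight is at most \<open>b\<close> wherever the
  error can be nonzero, so \<open>C\<close> is \<open>b\<close> times a Lipschitz constant of
  \<open>g\<close> times the constant of the mesh; it is uniform in \<open>x\<close>.\<close>

lemma antimono_interpolation_rate:
  fixes F z :: "nat \<Rightarrow> _ \<Rightarrow> real" and g :: "real \<Rightarrow> real"
  assumes g: "g C1_differentiable_on {0<..}" "antimono_on {0<..} g"
    and F: "\<And>n. n \<ge> 1 \<Longrightarrow> antimono_on {0<..} (F n)"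
    and ends: "\<And>n. n \<ge> 1 \<Longrightarrow> z n 0 = a \<and> z n n = b"
    and pos: "\<And>n i. z n i > 0"
    and nodes: "\<And>n i. n \<ge> 1 \<Longrightarrow> i \<le> n \<Longrightarrow> F n (z n i) = g (z n i)"
    and outside: "\<And>n x. n \<ge> 1 \<Longrightarrow> x \<in> {0<..<a} \<union> {b<..} \<Longrightarrow> F n x = g x"
    and mesh: "(\<lambda>n. Max ((\<lambda>i. \<bar>z n i - z n (Suc i)\<bar>) ` {..<n})) \<in> O(\<lambda>n. 1 / real n)"
  obtains C where "C \<ge> 0" "\<forall>\<^sub>F n in sequentially. \<forall>x>0. \<bar>x * (F n x - g x)\<bar> \<le> C / real n"
proof -
  have ab: "a > 0" "b > 0" using ends[of 1] pos by (metis order_refl)+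
  \<comment> \<open>A cell that meets \<open>{a..b}\<close> may stick out of it. Once the mesh is
    below \<open>a / 2\<close>, both nodes of such a cell lie in the enlarged interval, which still
    stays away from the singularity at 0.\<close>
  obtain L where L: "L \<ge> 0"
    "\<And>x y. x \<in> {a/2..b+a} \<Longrightarrow> y \<in> {a/2..b+a} \<Longrightarrow> \<bar>g x - g y\<bar> \<le> L * \<bar>x - y\<bar>"
  proof (rule C1_lipschitz_on_Icc[OF g(1)])
    show "{a/2..b+a} \<subseteq> {0<..}" using ab by auto
  qed (rule that)
  obtain c where c: "c > 0" "\<forall>\<^sub>F n in sequentially.
      norm (Max ((\<lambda>i. \<bar>z n i - z n (Suc i)\<bar>) ` {..<n})) \<le> c * norm (1 / real n)"
    using landau_o.bigE[OF mesh] by blast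
  have small: "\<forall>\<^sub>F n in sequentially. c / real n < a / 2"
    using ab by (intro order_tendstoD(2)[OF lim_const_over_n]) simp
  have "\<forall>\<^sub>F n in sequentially. \<forall>x>0. \<bar>x * (F n x - g x)\<bar> \<le> (b * (L * c)) / real n"
    using c(2) small eventually_ge_at_top[of 1]
  proof eventually_elim
    fix n :: nat
    assume Mx: "norm (Max ((\<lambda>i. \<bar>z n i - z n (Suc i)\<bar>) ` {..<n})) \<le> c * norm (1 / real n)"
      and sm: "c / real n < a / 2" and n: "1 \<le> n"
    have step: "\<bar>z n i - z n (Suc i)\<bar> \<le> c / real n" if "i < n" for i
    proof -
      have "\<bar>z n i - z n (Suc i)\<bar> \<le> Max ((\<lambda>i. \<bar>z n i - z n (Suc i)\<bar>) ` {..<n})"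
        using that by (intro Max_ge) auto
      then show ?thesis using Mx by simp
    qed
    show "\<forall>x>0. \<bar>x * (F n x - g x)\<bar> \<le> (b * (L * c)) / real n"
    proof (intro allI impI)
      fix x :: real assume x: "x > 0"
      show "\<bar>x * (F n x - g x)\<bar> \<le> (b * (L * c)) / real n"
      proof (cases "x \<in> {a..b}")
        case False
        then have "F n x = g x" using x by (intro outside[OF n]) auto
        then show ?thesis using ab L(1) c(1) by simp
      next
        case True
        obtain i where i: "i < n" "z n i \<le> x" "x \<le> z n (Suc i)"
          using exists_bracketing_index[of "z n" x n] True ends[OF n] n by auto
        have "g (z n (Suc i)) \<le> g x" "g x \<le> g (z n i)"
          using i pos x by (auto intro!: monotone_onD[OF g(2)])
        moreover have "F n (z n (Suc i)) \<le> F n x" "F n x \<le> F n (z n i)"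
          using i pos x by (auto intro!: monotone_onD[OF F[OF n]])
        \<comment> \<open>Both values at \<open>x\<close> lie between the two common nodal values,
          so their distance is at most the length of that range.\<close>
        ultimately have "\<bar>F n x - g x\<bar> \<le> \<bar>g (z n i) - g (z n (Suc i))\<bar>"
          using i(1) nodes[OF n] by simp
        also have "\<dots> \<le> L * \<bar>z n i - z n (Suc i)\<bar>"
        proof (rule L(2))
          show "z n i \<in> {a/2..b+a}" "z n (Suc i) \<in> {a/2..b+a}"
            unfolding atLeastAtMost_iff using step[OF i(1)] sm i True ab
            by (simp_all only: atLeastAtMost_iff) linarith+
        qed
        also have "\<dots> \<le> L * (c / real n)"
          by (intro mult_left_mono step i L)
        finally have "x * \<bar>F n x - g x\<bar> \<le> b * (L * (c / real n))"
          using True ab by (intro mult_mono) auto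
        then show ?thesis using x by (simp add: abs_mult)
      qed
    qed
  qed
  moreover have "b * (L * c) \<ge> 0" using ab L(1) c(1) by simp
  ultimately show thesis by (rule that[rotated])
qed

section \<open>From terminal wealth to wealth processes\<close>

lemma (in sigma_finite_subalgebra) abs_real_cond_exp_diff_le:
  assumes "integrable M f" "integrable M g" "AE x in M. \<bar>f x - g x\<bar> \<le> c"
  shows "AE x in M. \<bar>real_cond_exp M F f x - real_cond_exp M F g x\<bar> \<le> c"
proof -
  have "AE x in M. - c \<le> real_cond_exp M F (\<lambda>x. f x - g x) x"
    using assms by (intro real_cond_exp_ge_c) (auto elim: eventually_mono)
  moreover have "AE x in M. real_cond_exp M F (\<lambda>x. f x - g x) x \<le> c"
    using assms by (intro real_cond_exp_le_c) (auto elim: eventually_mono)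
  ultimately show ?thesis using real_cond_exp_diff[OF assms(1,2)] by eventually_elim auto
qed

text \<open>The factor \<open>inverse (\<xi> t \<omega>)\<close> is common to both processes and
  comes out of the difference; what is left is a difference of conditional expectations, which
  inherits the deterministic bound \<open>c\<close>. The exceptional null set may depend on
  \<open>t\<close>.\<close>

lemma wealth_process_diff_le:
  assumes W: "standard_brownian_motion M T W" and t: "t \<in> {0..T}"
    and \<xi>: "\<And>\<omega>. \<xi> t \<omega> > 0"
    and X: "wealth_process M T W \<xi> A X" "integrable M (\<lambda>\<omega>. \<xi> T \<omega> * A \<omega>)"
    and Y: "wealth_process M T W \<xi> B Y" "integrable M (\<lambda>\<omega>. \<xi> T \<omega> * B \<omega>)"
    and c: "\<And>\<omega>. \<bar>\<xi> T \<omega> * (A \<omega> - B \<omega>)\<bar> \<le> c"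
  shows "AE \<omega> in M. \<bar>X t \<omega> - Y t \<omega>\<bar> \<le> c * inverse (\<xi> t \<omega>)"
proof -
  interpret prob_space M using W by (simp add: standard_brownian_motion_def)
  interpret finite_measure_subalgebra M "augmented_filtration M W t"
    using subalgebra_augmented_filtration[OF W, of t] t by unfold_locales auto
  let ?E = "real_cond_exp M (augmented_filtration M W t)"
  have "AE \<omega> in M. \<bar>?E (\<lambda>\<omega>. \<xi> T \<omega> * A \<omega>) \<omega> - ?E (\<lambda>\<omega>. \<xi> T \<omega> * B \<omega>) \<omega>\<bar> \<le> c"
    using c by (intro abs_real_cond_exp_diff_le X Y) (simp add: right_diff_distrib)
  moreover have "AE \<omega> in M. X t \<omega> = inverse (\<xi> t \<omega>) * ?E (\<lambda>\<omega>. \<xi> T \<omega> * A \<omega>) \<omega>"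
    and "AE \<omega> in M. Y t \<omega> = inverse (\<xi> t \<omega>) * ?E (\<lambda>\<omega>. \<xi> T \<omega> * B \<omega>) \<omega>"
    using X(1) Y(1) t by (auto simp: wealth_process_def)
  ultimately show ?thesis
  proof eventually_elim
    case (elim \<omega>)
    have "\<bar>X t \<omega> - Y t \<omega>\<bar> = inverse (\<xi> t \<omega>)
        * \<bar>?E (\<lambda>\<omega>. \<xi> T \<omega> * A \<omega>) \<omega> - ?E (\<lambda>\<omega>. \<xi> T \<omega> * B \<omega>) \<omega>\<bar>"
      using \<xi>[of \<omega>] by (simp only: elim right_diff_distrib[symmetric] abs_mult) simp
    also have "\<dots> \<le> inverse (\<xi> t \<omega>) * c"
      using \<xi>[of \<omega>] elim(1) by (intro mult_left_mono) auto
    finally show ?case by (simp add: mult.commute)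
  qed
qed

lemma integrable_from_nn_bound:
  fixes f :: "'a \<Rightarrow> real"
  assumes "f \<in> borel_measurable M" "\<And>\<omega>. f \<omega> \<ge> 0" "c \<ge> 0"
    and "(\<integral>\<^sup>+\<omega>. ennreal (f \<omega>) \<partial>M) \<le> ennreal c"
  shows "integrable M f" "(\<integral>\<omega>. f \<omega> \<partial>M) \<le> c"
proof -
  show "integrable M f"
    using assms by (intro integrableI_bounded) (auto intro: le_less_trans)
  show "(\<integral>\<omega>. f \<omega> \<partial>M) \<le> c"
    using assms(3,4) by (rule integral_real_bounded)
qed

text \<open>Because the bound is uniform in \<open>t\<close>, Tonelli gives a finite integral over
  the product of time and probability space. All three claims are then instances of Fubini.\<close>

lemma (in sigma_finite_measure) integral_time_integral_le:
  fixes f :: "real \<Rightarrow> 'a \<Rightarrow> real"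
  assumes f: "case_prod f \<in> borel_measurable (restrict_space borel {0..T} \<Otimes>\<^sub>M M)"
    and nonneg: "\<And>t \<omega>. f t \<omega> \<ge> 0" and T: "T \<ge> 0" and c: "c \<ge> 0"
    and bound: "\<And>t. t \<in> {0..T} \<Longrightarrow> (\<integral>\<^sup>+\<omega>. ennreal (f t \<omega>) \<partial>M) \<le> ennreal c"
  shows "AE \<omega> in M. set_integrable lborel {0..T} (\<lambda>t. f t \<omega>)" (is ?A)
    and "integrable M (\<lambda>\<omega>. LINT t:{0..T}|lborel. f t \<omega>)" (is ?B)
    and "(\<integral>\<omega>. (LINT t:{0..T}|lborel. f t \<omega>) \<partial>M) \<le> T * c" (is ?C)
proof -
  \<comment> \<open>Measurability is given only over \<open>{0..T}\<close>, so the time measure is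
    Lebesgue measure restricted to it. Its finiteness makes constants integrable in time.\<close>
  let ?R = "restrict_space lborel {0..T}"
  have sR: "sets ?R = sets (restrict_space borel {0..T})"
    by (rule sets_restrict_space_cong) simp
  have f'[measurable]: "case_prod f \<in> borel_measurable (?R \<Otimes>\<^sub>M M)"
    using f by (simp cong: measurable_cong_sets add: sets_pair_measure_cong[OF sR refl])
  have emR: "emeasure ?R (space ?R) = ennreal T"
    using T by (simp add: emeasure_restrict_space)
  interpret R: finite_measure ?R
    by (rule finite_measureI) (metis emR ennreal_neq_top infinity_ennreal_def)
  interpret P: pair_sigma_finite ?R M ..
  have prod: "integrable (?R \<Otimes>\<^sub>M M) (case_prod f)" 
    and le: "(\<integral>\<^sup>+ x. \<integral>\<^sup>+ y. ennreal (f x y) \<partial>M \<partial>?R) \<le> ennreal (T * c)"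
  proof -
    have "(\<integral>\<^sup>+ x. \<integral>\<^sup>+ y. ennreal (f x y) \<partial>M \<partial>?R) \<le> (\<integral>\<^sup>+ x. ennreal c \<partial>?R)"
      using bound by (intro nn_integral_mono) (simp add: space_restrict_space)
    also have "\<dots> = ennreal (T * c)"
      using emR T c by (simp add: ennreal_mult mult.commute)
    finally show le: "(\<integral>\<^sup>+ x. \<integral>\<^sup>+ y. ennreal (f x y) \<partial>M \<partial>?R) \<le> ennreal (T * c)" .
    have "(\<integral>\<^sup>+ p. ennreal (case_prod f p) \<partial>(?R \<Otimes>\<^sub>M M)) \<le> ennreal (T * c)"
      using le by (subst nn_integral_fst[symmetric]) auto
    then show "integrable (?R \<Otimes>\<^sub>M M) (case_prod f)"
      using nonneg T c by (intro integrable_from_nn_bound(1)[of _ _ "T * c"]) auto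
  qed
  have eq: "(LINT t:{0..T}|lborel. f t \<omega>) = (\<integral>t. f t \<omega> \<partial>?R)" for \<omega>
    by (subst integral_restrict_space) (auto simp: set_lebesgue_integral_def)
  show ?A
    using P.AE_integrable_snd[OF prod]
    by (simp add: integrable_restrict_space set_integrable_def)
  show ?B
    unfolding eq by (rule P.integrable_snd[OF prod])
  have "(\<integral>\<omega>. (\<integral>t. f t \<omega> \<partial>?R) \<partial>M) = (\<integral>t. (\<integral>\<omega>. f t \<omega> \<partial>M) \<partial>?R)"
    by (rule P.Fubini_integral[OF prod])
  also have "\<dots> \<le> (\<integral>t. c \<partial>?R)"
  proof (rule integral_mono)
    show "integrable ?R (\<lambda>t. \<integral>\<omega>. f t \<omega> \<partial>M)" by (rule P.integrable_fst[OF prod])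
    show "(\<integral>\<omega>. f t \<omega> \<partial>M) \<le> c" if "t \<in> space ?R" for t
      using that c bound[of t] by (intro integral_real_bounded) (auto simp: space_restrict_space)
  qed simp
  also have "\<dots> = T * c"
    using emR T by (simp add: measure_def)
  finally show ?C unfolding eq .
qed

section \<open>The three convergence rates\<close>

theorem corollary1:
  fixes M :: "'a measure" and W :: "real \<Rightarrow> 'a \<Rightarrow> real ^ 'm::finite"
    and T x\<^sub>0 r :: real and \<mu> \<theta> :: "real ^ 'm" and \<sigma> :: "real ^ 'm ^ 'm"
    and \<xi> :: "real \<Rightarrow> 'a \<Rightarrow> real"
    and p\<^sub>0 p\<^sub>1 \<kappa>\<^sub>0 \<kappa>\<^sub>1 :: real
    and p z y :: "nat \<Rightarrow> nat \<Rightarrow> real"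
    and Xopt :: "real \<Rightarrow> real" and Xfit :: "nat \<Rightarrow> real \<Rightarrow> real"
    and wopt :: "real \<Rightarrow> 'a \<Rightarrow> real" and wfit :: "nat \<Rightarrow> real \<Rightarrow> 'a \<Rightarrow> real"
  assumes T: "T > 0" and x0: "x\<^sub>0 > 0"
    and W: "standard_brownian_motion M T W"
    and \<sigma>: "pos_def_matrix \<sigma>"
    and \<theta>: "\<theta> = market_price_of_risk r \<mu> \<sigma>" "\<theta> \<noteq> 0"
    and \<xi>: "\<xi> = pricing_kernel r \<theta> W"
    and p01: "0 < p\<^sub>1" "p\<^sub>1 < p\<^sub>0" "p\<^sub>0 < 1"
    and \<kappa>: "\<kappa>\<^sub>0 > 0" "\<kappa>\<^sub>1 > 0"
    and \<comment> \<open>the given probabilities, the levels of the pricing kernel and the wealth levels\<close>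
        p_ends: "\<And>n. n \<ge> 1 \<Longrightarrow> p n 0 = p\<^sub>0 \<and> p n n = p\<^sub>1"
    and p_decreasing: "\<And>n i. n \<ge> 1 \<Longrightarrow> i < n \<Longrightarrow> p n (Suc i) < p n i"
    and p_refine: "\<And>n. n \<ge> 1 \<Longrightarrow>
          \<exists>q\<in>{p\<^sub>1<..<p\<^sub>0}. q \<notin> p n ` {..n} \<and> p (Suc n) ` {..Suc n} = insert q (p n ` {..n})"
    and z: "\<And>n i. z n i = kernel_level r \<theta> T (p n i)"
    and y: "\<And>n i. n \<ge> 1 \<Longrightarrow> i \<le> n \<Longrightarrow> y n i = Xopt (z n i)"
    and y_ends: "y 1 0 = \<kappa>\<^sub>0 / kernel_level r \<theta> T p\<^sub>0" "y 1 1 = \<kappa>\<^sub>1 / kernel_level r \<theta> T p\<^sub>1"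
      "y 1 0 \<ge> y 1 1"
    and \<comment> \<open>the optimal terminal wealth\<close>
        Xopt_class: "Xopt \<in> wealth_class"
    and Xopt_budget: "has_bochner_integral M (\<lambda>\<omega>. \<xi> T \<omega> * Xopt (\<xi> T \<omega>)) x\<^sub>0"
    and Xopt_left: "\<And>x. 0 < x \<Longrightarrow> x < kernel_level r \<theta> T p\<^sub>0 \<Longrightarrow> Xopt x = \<kappa>\<^sub>0 / x"
    and Xopt_right: "\<And>x. x > kernel_level r \<theta> T p\<^sub>1 \<Longrightarrow> Xopt x = \<kappa>\<^sub>1 / x"
    and \<comment> \<open>the budget bounds\<close>
        budget_lower: "\<And>n. n \<ge> 1 \<Longrightarrow>
          (\<Sum>i<n. y n (Suc i) *
              (\<integral>\<omega>. \<xi> T \<omega> * indicator {z n i<..<z n (Suc i)} (\<xi> T \<omega>) \<partial>M))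
            + \<kappa>\<^sub>0 * (1 - p\<^sub>0) + \<kappa>\<^sub>1 * p\<^sub>1 \<le> x\<^sub>0"
    and budget_upper: "\<And>n. n \<ge> 1 \<Longrightarrow>
          x\<^sub>0 < (\<Sum>i<n. y n i *
              (\<integral>\<omega>. \<xi> T \<omega> * indicator {z n i<..<z n (Suc i)} (\<xi> T \<omega>) \<partial>M))
            + \<kappa>\<^sub>0 * (1 - p\<^sub>0) + \<kappa>\<^sub>1 * p\<^sub>1"
    and \<comment> \<open>the fitted terminal wealth\<close>
        Xfit_class: "\<And>n. n \<ge> 1 \<Longrightarrow> Xfit n \<in> wealth_class"
    and Xfit_outside: "\<And>n x. n \<ge> 1 \<Longrightarrow> x \<in> {0<..<z n 0} \<union> {z n n<..} \<Longrightarrow> Xfit n x = Xopt x"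
    and Xfit_nodes: "\<And>n i. n \<ge> 1 \<Longrightarrow> i \<le> n \<Longrightarrow> Xfit n (z n i) = y n i"
    and Xfit_hyperbolic: "\<And>n i. n \<ge> 1 \<Longrightarrow> i < n \<Longrightarrow>
          hyperbolic_on {z n i<..<z n (Suc i)} (Xfit n)"
    and Xfit_budget: "\<And>n. n \<ge> 1 \<Longrightarrow>
          has_bochner_integral M (\<lambda>\<omega>. \<xi> T \<omega> * Xfit n (\<xi> T \<omega>)) x\<^sub>0"
    and \<comment> \<open>the wealth processes\<close>
        wopt: "wealth_process M T W \<xi> (\<lambda>\<omega>. Xopt (\<xi> T \<omega>)) wopt"
    and wfit: "\<And>n. n \<ge> 1 \<Longrightarrow> wealth_process M T W \<xi> (\<lambda>\<omega>. Xfit n (\<xi> T \<omega>)) (wfit n)"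
    and \<comment> \<open>the two assumptions of the result\<close>
        Xopt_C1: "Xopt C1_differentiable_on {0<..}"
    and mesh: "(\<lambda>n. Max ((\<lambda>i. \<bar>z n i - z n (Suc i)\<bar>) ` {..<n})) \<in> O(\<lambda>n. 1 / real n)"
  shows "(\<forall>t\<in>{0..T}. AE \<omega> in M. (\<lambda>n. \<bar>wfit n t \<omega> - wopt t \<omega>\<bar>) \<in> O(\<lambda>n. 1 / real n)) \<and>
    (\<forall>t\<in>{0..T}.
       (\<forall>\<^sub>F n in sequentially. integrable M (\<lambda>\<omega>. \<bar>wfit n t \<omega> - wopt t \<omega>\<bar>)) \<and>
       (\<lambda>n. \<integral>\<omega>. \<bar>wfit n t \<omega> - wopt t \<omega>\<bar> \<partial>M) \<in> O(\<lambda>n. 1 / real n)) \<and>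
    (\<forall>\<^sub>F n in sequentially.
       (AE \<omega> in M. set_integrable lborel {0..T} (\<lambda>t. \<bar>wfit n t \<omega> - wopt t \<omega>\<bar>)) \<and>
       integrable M (\<lambda>\<omega>. LINT t:{0..T}|lborel. \<bar>wfit n t \<omega> - wopt t \<omega>\<bar>)) \<and>
    (\<lambda>n. \<integral>\<omega>. (LINT t:{0..T}|lborel. \<bar>wfit n t \<omega> - wopt t \<omega>\<bar>) \<partial>M) \<in> O(\<lambda>n. 1 / real n)"
proof -
  interpret prob_space M using W by (simp add: standard_brownian_motion_def)
  have z_pos: "z n i > 0" for n i by (simp add: z kernel_level_def)
  obtain C where C: "C \<ge> 0" "\<forall>\<^sub>F n in sequentially. \<forall>x>0. \<bar>x * (Xfit n x - Xopt x)\<bar> \<le> C / real n"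
  proof (rule antimono_interpolation_rate)
    show "Xopt C1_differentiable_on {0<..}" by (rule Xopt_C1)
    show "antimono_on {0<..} Xopt" using Xopt_class by (simp add: wealth_class_def)
    show "antimono_on {0<..} (Xfit n)" if "n \<ge> 1" for n
      using Xfit_class[OF that] by (simp add: wealth_class_def)
    show ends: "z n 0 = kernel_level r \<theta> T p\<^sub>0 \<and> z n n = kernel_level r \<theta> T p\<^sub>1" if "n \<ge> 1" for n
      using p_ends[OF that] by (simp add: z)
    show "Xfit n (z n i) = Xopt (z n i)" if "n \<ge> 1" "i \<le> n" for n i
      using Xfit_nodes[OF that] y[OF that] by simp
    show "Xfit n x = Xopt x"
      if "n \<ge> 1" "x \<in> {0<..<kernel_level r \<theta> T p\<^sub>0} \<union> {kernel_level r \<theta> T p\<^sub>1<..}" for n x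
      using that by (intro Xfit_outside) (simp_all add: ends)
  qed (use z_pos mesh in auto)
  \<comment> \<open>The properties of the fits are available from index 1 on, and the error bound
    only eventually; \<open>good\<close> collects both conditions.\<close>
  define good where "good n \<longleftrightarrow> n \<ge> 1 \<and> (\<forall>x>0. \<bar>x * (Xfit n x - Xopt x)\<bar> \<le> C / real n)" for n
  have good: "\<forall>\<^sub>F n in sequentially. good n"
    using C(2) eventually_ge_at_top[of 1] unfolding good_def by eventually_elim simp
  \<comment> \<open>A bound for the expectation of the inverse kernel, uniform over
    \<open>{0..T}\<close>. The absolute value covers a negative exponent, as \<open>r\<close> may be
    negative.\<close>
  define G where "G = exp (\<bar>r + (norm \<theta>)\<^sup>2\<bar> * T)"
  have \<xi>_pos: "\<xi> t \<omega> > 0" for t \<omega> by (simp add: \<xi> pricing_kernel_pos)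
  have diff_le: "AE \<omega> in M. \<bar>wfit n t \<omega> - wopt t \<omega>\<bar> \<le> C / real n * inverse (\<xi> t \<omega>)"
    if "good n" "t \<in> {0..T}" for n t
  proof (rule wealth_process_diff_le[OF W that(2) \<xi>_pos])
    show "wealth_process M T W \<xi> (\<lambda>\<omega>. Xfit n (\<xi> T \<omega>)) (wfit n)"
      and "integrable M (\<lambda>\<omega>. \<xi> T \<omega> * Xfit n (\<xi> T \<omega>))"
      using wfit[of n] Xfit_budget[of n] that(1) by (auto simp: good_def has_bochner_integral_iff)
    show "integrable M (\<lambda>\<omega>. \<xi> T \<omega> * Xopt (\<xi> T \<omega>))"
      using Xopt_budget by (simp add: has_bochner_integral_iff)
    show "\<bar>\<xi> T \<omega> * (Xfit n (\<xi> T \<omega>) - Xopt (\<xi> T \<omega>))\<bar> \<le> C / real n" for \<omega>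
      using that(1) \<xi>_pos by (simp add: good_def)
  qed (rule wopt)
  \<comment> \<open>The right-hand side does not depend on \<open>t\<close>, so the same estimate
    serves both the expectation at a fixed time and the time integral.\<close>
  have nn_le: "(\<integral>\<^sup>+\<omega>. ennreal \<bar>wfit n t \<omega> - wopt t \<omega>\<bar> \<partial>M) \<le> ennreal (C / real n * G)"
    if n: "good n" and t: "t \<in> {0..T}" for n t
  proof -
    have [measurable]: "W t \<in> borel_measurable M"
      using W t by (auto simp: standard_brownian_motion_def)
    have [measurable]: "\<xi> t \<in> borel_measurable M"
      unfolding \<xi> pricing_kernel_def by measurable
    have "(\<integral>\<^sup>+\<omega>. ennreal \<bar>wfit n t \<omega> - wopt t \<omega>\<bar> \<partial>M)
        \<le> (\<integral>\<^sup>+\<omega>. ennreal (C / real n) * ennreal (inverse (\<xi> t \<omega>)) \<partial>M)"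
      using diff_le[OF n t] C(1) \<xi>_pos
      by (intro nn_integral_mono_AE)
        (auto elim!: eventually_mono simp: less_imp_le ennreal_leI simp flip: ennreal_mult)
    also have "\<dots> = ennreal (C / real n) * ennreal (exp ((r + (norm \<theta>)\<^sup>2) * t))"
      using nn_integral_inverse_pricing_kernel[OF W, of t r \<theta>] t
      by (subst nn_integral_cmult) (simp_all add: \<xi>[symmetric])
    also have "\<dots> \<le> ennreal (C / real n) * ennreal G"
    proof -
      have "(r + (norm \<theta>)\<^sup>2) * t \<le> \<bar>r + (norm \<theta>)\<^sup>2\<bar> * T"
        using t by (intro mult_mono) auto
      then show ?thesis unfolding G_def by (intro mult_left_mono ennreal_leI) auto
    qed
    finally show ?thesis using C(1) by (simp add: G_def flip: ennreal_mult)
  qed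
  have meas2: "(\<lambda>(t, \<omega>). \<bar>wfit n t \<omega> - wopt t \<omega>\<bar>) \<in> borel_measurable (restrict_space borel {0..T} \<Otimes>\<^sub>M M)"
    if "good n" for n
    using wfit[of n] wopt that
    by (auto simp: wealth_process_def good_def split_def intro!: borel_measurable_abs borel_measurable_diff)
  \<comment> \<open>Sections of a jointly measurable function are measurable, which covers each
    fixed time.\<close>
  have meas1: "(\<lambda>\<omega>. \<bar>wfit n t \<omega> - wopt t \<omega>\<bar>) \<in> borel_measurable M" if "good n" "t \<in> {0..T}" for n t
    using measurable_compose_Pair1[OF _ meas2[OF that(1)], of t] that(2) by (simp add: space_restrict_space)
  have bound_nonneg: "C / real n * G \<ge> 0" for n using C(1) by (simp add: G_def)
  note expectation = integrable_from_nn_bound[OF meas1 abs_ge_zero bound_nonneg nn_le]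
  note time_integral = integral_time_integral_le[OF meas2 abs_ge_zero less_imp_le[OF T] bound_nonneg nn_le]
  have "AE \<omega> in M. (\<lambda>n. \<bar>wfit n t \<omega> - wopt t \<omega>\<bar>) \<in> O(\<lambda>n. 1 / real n)" if t: "t \<in> {0..T}" for t
  proof -
    \<comment> \<open>The null set in \<open>diff_le\<close> depends on \<open>n\<close>; a
      countable union provides one that works for all \<open>n\<close>. The constant of the almost
      sure rate, \<open>C * inverse (\<xi> t \<omega>)\<close>, varies with the path.\<close>
    have "AE \<omega> in M. \<forall>n. good n \<longrightarrow> \<bar>wfit n t \<omega> - wopt t \<omega>\<bar> \<le> C / real n * inverse (\<xi> t \<omega>)"
      using diff_le[OF _ t] by (simp add: AE_all_countable)
    then show ?thesis
    proof eventually_elim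
      case (elim \<omega>)
      have "\<forall>\<^sub>F n in sequentially.
          norm \<bar>wfit n t \<omega> - wopt t \<omega>\<bar> \<le> (C * inverse (\<xi> t \<omega>)) * norm (1 / real n)"
        using good by eventually_elim (use elim in simp)
      then show ?case by (rule bigoI)
    qed
  qed
  moreover have "(\<forall>\<^sub>F n in sequentially. integrable M (\<lambda>\<omega>. \<bar>wfit n t \<omega> - wopt t \<omega>\<bar>)) \<and>
      (\<lambda>n. \<integral>\<omega>. \<bar>wfit n t \<omega> - wopt t \<omega>\<bar> \<partial>M) \<in> O(\<lambda>n. 1 / real n)" if t: "t \<in> {0..T}" for t
  proof
    show "\<forall>\<^sub>F n in sequentially. integrable M (\<lambda>\<omega>. \<bar>wfit n t \<omega> - wopt t \<omega>\<bar>)"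
      using good by eventually_elim (rule expectation(1)[OF _ t _ t])
    have "\<forall>\<^sub>F n in sequentially.
        norm (\<integral>\<omega>. \<bar>wfit n t \<omega> - wopt t \<omega>\<bar> \<partial>M) \<le> (C * G) * norm (1 / real n)"
      using good by eventually_elim (use expectation(2)[OF _ t _ t] in \<open>simp add: integral_nonneg\<close>)
    then show "(\<lambda>n. \<integral>\<omega>. \<bar>wfit n t \<omega> - wopt t \<omega>\<bar> \<partial>M) \<in> O(\<lambda>n. 1 / real n)" by (rule bigoI)
  qed
  moreover have "\<forall>\<^sub>F n in sequentially.
      (AE \<omega> in M. set_integrable lborel {0..T} (\<lambda>t. \<bar>wfit n t \<omega> - wopt t \<omega>\<bar>)) \<and>
      integrable M (\<lambda>\<omega>. LINT t:{0..T}|lborel. \<bar>wfit n t \<omega> - wopt t \<omega>\<bar>)"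
    using good by eventually_elim (use time_integral(1,2) in blast)
  moreover have "(\<lambda>n. \<integral>\<omega>. (LINT t:{0..T}|lborel. \<bar>wfit n t \<omega> - wopt t \<omega>\<bar>) \<partial>M) \<in> O(\<lambda>n. 1 / real n)"
  proof (rule bigoI)
    have nonneg: "(LINT t:{0..T}|lborel. \<bar>wfit n t \<omega> - wopt t \<omega>\<bar>) \<ge> 0" for n \<omega>
      by (simp add: set_lebesgue_integral_def integral_nonneg)
    \<comment> \<open>Integrating the uniform bound \<open>C / real n * G\<close> over time costs
      only the factor \<open>T\<close>.\<close>
    show "\<forall>\<^sub>F n in sequentially.
        norm (\<integral>\<omega>. (LINT t:{0..T}|lborel. \<bar>wfit n t \<omega> - wopt t \<omega>\<bar>) \<partial>M)
          \<le> (T * (C * G)) * norm (1 / real n)"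
      using good by eventually_elim (use time_integral(3) nonneg in \<open>simp add: integral_nonneg\<close>)
  qed
  ultimately show ?thesis by blast
qed

end
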